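(* If $s = \Omega(n^{1/t} (t-1)!)$, then $\lambda_{s}(n, j)$ is between $\Omega(n^{2} s / (t-1)!)$ and $O(n^{2} s)$ for all $j \geq 2$.
   Context: All sequences are finite. Here $n$, $s$, $t$, $j$ are positive integers. Neither $s$ nor $t$ is assumed to be fixed: both may vary with $n$, and the dependence of the bounds on $t$ is the one displayed explicitly through $n^{1/t}$ and $(t-1)!$. The integer $j$ is fixed, and the implied constant in the lower bound may depend on $j$. A sequence is $j$-sparse if every contiguous subsequence of length $j$ has all letters distinct. A Davenport-Schinzel sequence of order $s$ is a sequence with no adjacent same letters that avoids alternations of length $s+2$, i.e. that has no (not necessarily contiguous) subsequence of the form $a\,b\,a\,b\dots$ of length $s+2$ with $a \neq b$. A $DS(n,s)$-sequence is a Davenport-Schinzel sequence of order $s$ with $n$ distinct letters. $\lambda_s(n,j)$ denotes the maximum possible length of a $j$-sparse $DS(n,s)$-sequence. *)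

theory Defs
  imports Complex_Main "HOL-Library.Sublist"
begin

fun alternation :: "'a \<Rightarrow> 'a \<Rightarrow> nat \<Rightarrow> 'a list" where
  "alternation a b 0 = []"
| "alternation a b (Suc k) = a # alternation b a k"

definition j_sparse :: "nat \<Rightarrow> 'a list \<Rightarrow> bool" where
  "j_sparse j w \<longleftrightarrow> (\<forall>u. sublist u w \<and> length u = j \<longrightarrow> distinct u)"

definition davenport_schinzel :: "nat \<Rightarrow> 'a list \<Rightarrow> bool" where
  "davenport_schinzel s w \<longleftrightarrow>
     distinct_adj w \<and> (\<forall>a b. a \<noteq> b \<longrightarrow> \<not> subseq (alternation a b (s + 2)) w)"

definition DS :: "nat \<Rightarrow> nat \<Rightarrow> 'a list set" where
  "DS n s = {w. davenport_schinzel s w \<and> card (set w) = n}"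

(* Only the number of letters matters, so letters are taken to be natural numbers.
   For s \<ge> 1 the set below is nonempty (n distinct letters in a row) and finite, so Max is the
   true maximum: adjacent positions of w carry two distinct letters a, b and form an a/b change in
   the restriction of w to {a, b}, which has at most s changes; so length w \<le> (n choose 2) * s + 1. *)
definition DS_max :: "nat \<Rightarrow> nat \<Rightarrow> nat \<Rightarrow> nat" where
  "DS_max s n j = Max {length w |w :: nat list. w \<in> DS n s \<and> j_sparse j w}"

end

theory Submission
  imports Defs "HOL-Algebra.Algebraic_Closure_Type" "HOL-Library.Z2" "HOL-Library.FuncSet"
begin

text \<open>
The upper bound is a count. If the pattern \<open>a b\<close> occurs at \<open>k\<close> pairs of adjacent positions, then
\<open>a b a b \<dots>\<close> of length \<open>2 k\<close> is a subsequence, so \<open>k \<le> s\<close>; every two adjacent positions carry one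
of the \<open>n (n - 1)\<close> ordered pairs of distinct letters, whence \<open>length w \<le> n\<^sup>2 s\<close>
(\<open>length_DS_le\<close>).

For the lower bound write \<open>t = h + 1\<close>. The letters are codewords of an extended Reed--Solomon code
over a field with \<open>q\<close> elements, \<open>q\<close> about \<open>n\<close> to the power \<open>1 / t\<close>. Codewords have coordinates
\<open>0, \<dots>, q\<close>; two distinct ones agree in at most \<open>h\<close> coordinates, and any \<open>h + 1\<close> coordinates can be
prescribed. A choice of an \<open>h\<close>-subset of the coordinates below \<open>q\<close> and of values there singles out a
family of codewords, told apart by their last coordinate. Two letters share at most one family, as
the \<open>h\<close>-subset must lie in the set of at most \<open>h\<close> coordinates where they agree. There are
\<open>(q choose h) q\<^sup>h\<close> families, about \<open>q\<close> to the power \<open>2 h\<close> divided by \<open>h!\<close>. Each has about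
\<open>n / q\<^sup>h\<close> letters, and up to a constant depending on \<open>j\<close> the square of this number of blocks of
\<open>j\<close> letters can be formed in it such that any two letters share at most one block
(\<open>runs_line_blocks\<close>). Repeating every block \<open>k\<close> times gives length about \<open>n\<^sup>2 k / h!\<close>, while a
pair of letters has at most \<open>2 k\<close> runs inside its common block.

The remaining alternations come from stretches that contain only one letter of the pair. The families
are arranged along a recursion over the coordinates, so that coordinates in which the two letters
differ contribute long stretches of that kind; all of them together cost at most
\<open>2 q \<cdot> 2\<^sup>h + q\<close> (\<open>runs_grid\<close>). Since \<open>2\<^sup>h\<close> is small compared with \<open>h!\<close>, this is at most
\<open>s / 2\<close> once \<open>h\<close> is large, however small the constant in \<open>s = \<Omega>(q h!)\<close> is, and \<open>k\<close> can be taken of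
order \<open>s\<close>. Sparsity is free: each letter has one of \<open>j\<close> colours, each block contains every colour
once in a fixed order, and so the colours of the whole word are periodic.

As \<open>q\<close> is a power of two, it can exceed \<open>n\<close> to the power \<open>1 / t\<close> by a factor of up to two. The loss
does not accumulate with \<open>h\<close>, for the number of letters is matched to \<open>n\<close> by letting the last
coordinate take only some of its \<open>q\<close> values; this works as soon as \<open>n\<close> is at least \<open>h\<close> to the
power \<open>h (h + 1)\<close> and \<open>h\<close> is large (\<open>DS_max_ge_large_n\<close>). For smaller \<open>n\<close> the hypothesis for \<open>t\<close> implies the hypothesis
for \<open>t - 1\<close>, and for \<open>t\<close> below a constant depending on \<open>c\<close> and \<open>j\<close> it implies the hypothesis for
that constant, provided \<open>n\<close> is large (\<open>lower_bound_all_exponents\<close>).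
\<close>

section \<open>Alternations between two letters\<close>

text \<open>
For \<open>a \<noteq> b\<close> this is the length of a longest alternation of the two letters in \<open>w\<close>. Counting the
constant stretches makes subadditivity under concatenation visible.
\<close>

definition runs :: "'a \<Rightarrow> 'a \<Rightarrow> 'a list \<Rightarrow> nat" where
  "runs a b w = length (remdups_adj (filter (\<lambda>x. x \<in> {a, b}) w))"

lemma runs_Nil [simp]: "runs a b [] = 0"
  by (simp add: runs_def)

lemma length_remdups_adj_append_le:
  "length (remdups_adj (u @ v)) \<le> length (remdups_adj u) + length (remdups_adj v)"
proof (cases v)
  case (Cons x v')
  have "length (remdups_adj (u @ [x])) \<le> Suc (length (remdups_adj u))"
    by (cases u rule: rev_cases) (auto simp: remdups_adj_append_two)
  moreover have "length (tl (remdups_adj (x # v'))) = length (remdups_adj v) - 1"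
    using Cons by simp
  moreover have "length (remdups_adj v) \<ge> 1"
    using Cons by (simp add: remdups_adj_length_ge1)
  ultimately show ?thesis
    using Cons by (simp add: remdups_adj_append[of u x v'])
qed simp

lemma runs_append: "runs a b (u @ v) \<le> runs a b u + runs a b v"
  by (simp add: runs_def length_remdups_adj_append_le)

lemma runs_concat: "runs a b (concat ws) \<le> (\<Sum>w\<leftarrow>ws. runs a b w)"
  by (induction ws) (auto intro: order.trans[OF runs_append])

text \<open>
A factor that misses one of the two letters costs at most one run, however long it is. This is what makes
the nested arrangement of blocks cheap.
\<close>

lemma runs_le_of_bool:
  assumes "a \<notin> set w \<or> b \<notin> set w"
  shows "runs a b w \<le> of_bool (a \<in> set w) + of_bool (b \<in> set w)"
proof -
  define v where "v = filter (\<lambda>x. x \<in> {a, b}) w"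
  have "\<exists>x. set v \<subseteq> {x}"
    using assms by (auto simp: v_def)
  then obtain x where "set v \<subseteq> {x}" ..
  then have "v = replicate (length v) x"
    by (intro replicate_eqI) auto
  then have "length (remdups_adj v) \<le> of_bool (v \<noteq> [])"
    by (metis length_0_conv list.size(3) remdups_adj_replicate length_Cons of_bool_eq One_nat_def order_refl)
  moreover have "v \<noteq> [] \<longleftrightarrow> a \<in> set w \<or> b \<in> set w"
    by (auto simp: v_def filter_empty_conv)
  ultimately show ?thesis
    by (auto simp: runs_def v_def)
qed

lemma runs_distinct:
  assumes "distinct w" shows "runs a b w \<le> 2"
proof -
  have "length (filter (\<lambda>x. x \<in> {a, b}) w) = card (set (filter (\<lambda>x. x \<in> {a, b}) w))"
    using assms distinct_card distinct_filter by metis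
  also have "\<dots> \<le> card {a, b}"
    by (intro card_mono) auto
  also have "\<dots> \<le> 2"
    by (simp add: card_insert_if)
  finally show ?thesis
    unfolding runs_def by (meson order.trans remdups_adj_length)
qed

text \<open>
An embedding into \<open>w\<close> that uses distinct neighbours uses at most one letter of each constant stretch.
\<close>

lemma subseq_remdups_adj:
  assumes "distinct_adj u" "subseq u w"
  shows "subseq u (remdups_adj w)"
  using assms
proof (induction w arbitrary: u rule: remdups_adj.induct)
  case (3 x y w)
  show ?case
  proof (cases "x = y")
    case True
    have "subseq u (x # w)"
    proof (cases "u")
      case (Cons z u')
      then show ?thesis
      proof (cases "z = x")
        case True
        from "3.prems" Cons True \<open>x = y\<close> have "subseq u' (x # w)"
          by (simp add: subseq_Cons2_iff)
        moreover have "u' = [] \<or> hd u' \<noteq> x"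
          using "3.prems" Cons True by (auto simp: distinct_adj_Cons)
        ultimately have "subseq u' w"
          by (cases u') (auto simp: subseq_Cons2_neq)
        then show ?thesis using Cons True by simp
      qed (use "3.prems" \<open>x = y\<close> in \<open>auto simp: subseq_Cons2_neq\<close>)
    qed simp
    then show ?thesis using "3.IH"(1) "3.prems" True by simp
  next
    case False
    show ?thesis
    proof (cases "u \<noteq> [] \<and> hd u = x")
      case True
      then obtain u' where u: "u = x # u'" by (cases u) auto
      then have "subseq u' (remdups_adj (y # w))"
        using "3.IH"(2)[OF False, of u'] "3.prems" by (auto simp: distinct_adj_Cons)
      then show ?thesis using u False by simp
    next
      case False': False
      then have "subseq u (y # w)"
        using "3.prems" by (cases u) (auto simp: subseq_Cons2_neq)
      then have "subseq u (remdups_adj (y # w))"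
        using "3.IH"(2)[OF False, of u] "3.prems" by simp
      then show ?thesis using False by (simp add: list_emb_Cons)
    qed
  qed
qed auto

lemma length_alternation [simp]: "length (alternation a b k) = k"
  by (induction k arbitrary: a b) auto

lemma set_alternation: "set (alternation a b k) \<subseteq> {a, b}"
proof (induction k arbitrary: a b)
  case (Suc k)
  show ?case using Suc[of b a] by auto
qed simp

lemma distinct_adj_alternation:
  assumes "a \<noteq> b" shows "distinct_adj (alternation a b k)"
  using assms
proof (induction k arbitrary: a b)
  case (Suc k)
  then show ?case by (cases k) (auto simp: distinct_adj_Cons)
qed simp

lemma alternation_le_runs:
  assumes "a \<noteq> b" "subseq (alternation a b k) w"
  shows "k \<le> runs a b w"
proof -
  have "filter (\<lambda>x. x \<in> {a, b}) (alternation a b k) = alternation a b k"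
    using set_alternation[of a b k] by (intro filter_True) auto
  then have "subseq (alternation a b k) (filter (\<lambda>x. x \<in> {a, b}) w)"
    using assms(2) by (metis subseq_filter)
  then have "subseq (alternation a b k) (remdups_adj (filter (\<lambda>x. x \<in> {a, b}) w))"
    by (rule subseq_remdups_adj[OF distinct_adj_alternation[OF assms(1)]])
  then show ?thesis
    unfolding runs_def by (metis length_alternation list_emb_length)
qed

section \<open>The upper bound\<close>

fun adjacencies :: "'a \<Rightarrow> 'a \<Rightarrow> 'a list \<Rightarrow> nat" where
  "adjacencies a b (x # y # w) = of_bool (x = a \<and> y = b) + adjacencies a b (y # w)"
| "adjacencies a b _ = 0"

text \<open>
Occurrences of \<open>a b\<close> at adjacent positions cannot overlap when \<open>a \<noteq> b\<close>, so their letters line up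
to an alternation twice as long as their number.
\<close>

lemma alternation_adjacencies:
  assumes "a \<noteq> b"
  shows "subseq (alternation a b (2 * adjacencies a b w)) w"
proof (induction w rule: induct_list012)
  case (3 x y w)
  show ?case
  proof (cases "x = a \<and> y = b")
    case True
    have "subseq (alternation a b (2 * adjacencies a b (y # w))) w"
      using "3.IH"(2) True assms
      by (cases "adjacencies a b (y # w)") (auto simp: subseq_Cons2_neq)
    then show ?thesis using True by simp
  qed (use "3.IH"(2) in \<open>auto simp: list_emb_Cons\<close>)
qed auto

lemma sum_adjacencies:
  assumes "w \<noteq> []" "set w \<subseteq> A" "finite A"
  shows "(\<Sum>(a, b) \<in> A \<times> A. adjacencies a b w) = length w - 1"
  using assms
proof (induction w rule: induct_list012)
  case (3 x y w)
  have "(\<Sum>(a, b) \<in> A \<times> A. adjacencies a b (x # y # w)) =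
     (\<Sum>p \<in> A \<times> A. of_bool (p = (x, y))) + (\<Sum>(a, b) \<in> A \<times> A. adjacencies a b (y # w))"
    by (auto simp: sum.distrib[symmetric] intro!: sum.cong)
  also have "(\<Sum>p \<in> A \<times> A. of_bool (p = (x, y))) = (1::nat)"
    using 3 by (simp add: of_bool_def sum.delta)
  finally show ?case using 3 by auto
qed auto

lemma adjacencies_same: "distinct_adj w \<Longrightarrow> adjacencies a a w = 0"
  by (induction w rule: induct_list012) auto

lemma length_DS_le:
  assumes "w \<in> DS n s" "s \<ge> 1"
  shows "length w \<le> n ^ 2 * s"
proof (cases "w = []")
  case False
  have *: "adjacencies a b w \<le> (if a = b then 0 else s)" for a b
  proof (cases "a = b")
    case False
    have "\<not> 2 * adjacencies a b w \<ge> s + 2"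
    proof
      assume le: "2 * adjacencies a b w \<ge> s + 2"
      have "prefix (alternation a b k) (alternation a b l)" if "k \<le> l" for k l
        using that
      proof (induction k arbitrary: l a b)
        case (Suc k) then show ?case by (cases l) auto
      qed simp
      from this[OF le] have "subseq (alternation a b (s + 2)) w"
        using alternation_adjacencies[OF False, of w] by (meson prefix_imp_subseq subseq_order.trans)
      then show False using assms(1) False by (auto simp: DS_def davenport_schinzel_def)
    qed
    then show ?thesis using False assms(2) by simp
  qed (use assms in \<open>simp add: adjacencies_same DS_def davenport_schinzel_def\<close>)
  have card: "card (set w) = n" using assms(1) by (simp add: DS_def)
  then have n: "n > 0" using False by (auto simp: card_gt_0_iff)
  have "length w - 1 = (\<Sum>(a, b) \<in> set w \<times> set w. adjacencies a b w)"
    using False by (simp add: sum_adjacencies)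
  also have "\<dots> \<le> (\<Sum>(a, b) \<in> set w \<times> set w. if a = b then 0 else s)"
    using * by (intro sum_mono) auto
  also have "\<dots> = (\<Sum>a\<in>set w. \<Sum>b\<in>set w. if a = b then 0 else s)"
    by (simp add: sum.cartesian_product)
  also have "\<dots> = (\<Sum>a\<in>set w. \<Sum>b\<in>set w - {a}. s)"
    by (intro sum.cong refl sum.mono_neutral_cong_right) auto
  also have "\<dots> = n * ((n - 1) * s)"
    by (simp add: card)
  finally have "length w \<le> n * (n - 1) * s + 1" by (simp add: mult.assoc)
  also have "\<dots> \<le> n * (n - 1) * s + n * s" using n assms(2) by (simp add: Suc_leI)
  also have "\<dots> = n * s * ((n - 1) + 1)" by (simp add: algebra_simps)
  also have "\<dots> = n ^ 2 * s" using n by (simp add: power2_eq_square)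
  finally show ?thesis .
qed simp

text \<open>
The increasing word on \<open>n\<close> letters shows that the maximum is taken over a nonempty set.
\<close>

lemma DS_max_le:
  assumes "s \<ge> 1"
  shows "DS_max s n j \<le> n ^ 2 * s"
proof -
  let ?M = "{length w |w :: nat list. w \<in> DS n s \<and> j_sparse j w}"
  have "[0..<n] \<in> DS n s"
  proof -
    have "\<not> subseq (alternation a b (s + 2)) [0..<n]" if "a \<noteq> b" for a b
      using alternation_le_runs[OF that, of "s + 2" "[0..<n]"] runs_distinct[of "[0..<n]" a b] assms
      by auto
    then show ?thesis by (simp add: DS_def davenport_schinzel_def distinct_adj_conv_nth)
  qed
  moreover have "j_sparse j [0..<n]"
    unfolding j_sparse_def by (metis distinct_upt distinct_append sublist_def)
  ultimately have "?M \<noteq> {}" by auto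
  moreover have "?M \<subseteq> {..n ^ 2 * s}" using length_DS_le assms by auto
  ultimately have "Max ?M \<in> {..n ^ 2 * s}" by (meson Max_in finite_atMost finite_subset subsetD)
  then show ?thesis by (simp add: DS_max_def)
qed

section \<open>Reed--Solomon codes over fields of characteristic two\<close>

lemma CHAR_bit: "CHAR(bit) = 2"
proof (rule CHAR_eqI)
  fix x :: nat
  assume "of_nat x = (0 :: bit)"
  moreover have "of_nat x = (of_bool (odd x) :: bit)"
    by (induction x) auto
  ultimately show "2 dvd x"
    by auto
qed simp

text \<open>
The field with \<open>2\<^sup>i\<close> elements, as the set of roots of \<open>x\<^sup>q - x\<close> with \<open>q = 2\<^sup>i\<close> in an algebraic
closure of the field with two elements. The derivative of that polynomial is \<open>-1\<close>, so its \<open>q\<close>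
roots are distinct; the Frobenius map makes them closed under addition. Working with powers of two
provides a field with between \<open>x\<close> and \<open>2 x\<close> elements for every \<open>x \<ge> 2\<close>.
\<close>

lemma finite_field_power_two:
  assumes "i > 0"
  shows "\<exists>F :: bit alg_closure set. finite F \<and> card F = 2 ^ i \<and> 1 \<in> F \<and> 0 \<in> F \<and>
     (\<forall>x\<in>F. \<forall>y\<in>F. x + y \<in> F \<and> x * y \<in> F)"
proof -
  define q :: nat where "q = 2 ^ i"
  define p :: "bit alg_closure poly" where "p = Polynomial.monom 1 q - Polynomial.monom 1 1"
  define F where "F = {x. poly p x = 0}"
  have q: "q \<ge> 2" using assms by (cases i) (auto simp: q_def)
  have F_iff: "x \<in> F \<longleftrightarrow> x ^ q = x" for x
    by (simp add: F_def p_def poly_monom)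
  have deg: "Polynomial.degree p = q"
  proof (rule antisym)
    show "Polynomial.degree p \<le> q"
      using q unfolding p_def by (intro degree_diff_le) (auto intro: order.trans[OF Polynomial.degree_monom_le])
    show "q \<le> Polynomial.degree p"
      using q by (intro le_degree) (simp add: p_def)
  qed
  then have p: "p \<noteq> 0" using q by auto
  have char: "CHAR(bit alg_closure) = 2" by (simp add: CHAR_bit)
  have "of_nat q = (0 :: bit alg_closure)"
    unfolding of_nat_eq_0_iff_char_dvd char using assms by (simp add: q_def)
  then have pderiv: "pderiv p = -1"
    by (simp add: p_def pderiv_diff pderiv_monom)
  have order: "Polynomial.order x p = of_bool (x \<in> F)" for x
  proof -
    have "\<not> Polynomial.order x p \<ge> 2"
    proof
      assume "Polynomial.order x p \<ge> 2"
      then have "[:-x, 1:] ^ 2 dvd p"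
        by (simp add: order_divides p)
      then obtain r where "p = [:-x, 1:] ^ 2 * r" ..
      then have "poly (pderiv p) x = 0"
        by (simp only: power2_eq_square mult.assoc pderiv_mult poly_add poly_mult) simp
      then show False by (simp add: pderiv)
    qed
    moreover have "x \<in> F \<longleftrightarrow> Polynomial.order x p \<noteq> 0"
      using p by (simp add: F_def order_root)
    ultimately show ?thesis by auto
  qed
  obtain A where A: "size A = Polynomial.degree p"
     "p = Polynomial.smult (Polynomial.lead_coeff p) (\<Prod>x\<in>#A. [:-x, 1:])"
    using alg_closed_imp_factorization[OF p] by blast
  have "proots (\<Prod>x\<in>#B. [:-x, 1:]) = B" for B :: "bit alg_closure multiset"
  proof (induction B)
    case (add x B)
    have "(\<Prod>x\<in>#B. [:-x, 1:]) \<noteq> 0"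
      by (auto simp: prod_mset_zero_iff)
    then have "proots ([:-x, 1:] * (\<Prod>x\<in>#B. [:-x, 1:])) = {#x#} + B"
      using add by (subst proots_mult) (auto simp: proots_linear_factor simp del: mult_pCons_left)
    then show ?case by simp
  qed simp
  then have "proots p = A"
    using p by (subst A(2), subst proots_smult) auto
  moreover have "proots p = mset_set F"
  proof (rule multiset_eqI)
    fix x
    show "count (proots p) x = count (mset_set F) x"
      using p order[of x] by (simp add: count_mset_set' F_def poly_roots_finite)
  qed
  ultimately have "card F = q"
    using A(1) deg by (metis size_mset_set)
  moreover have "finite F" using p by (simp add: F_def poly_roots_finite)
  moreover have "(x + y) ^ q = x ^ q + y ^ q" for x y :: "bit alg_closure"
    by (rule freshmans_dream'[where n = i]) (simp_all add: CHAR_bit q_def)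
  then have "x + y \<in> F \<and> x * y \<in> F" if "x \<in> F" "y \<in> F" for x y
    using that by (simp add: F_iff power_mult_distrib)
  ultimately show ?thesis
    using q by (intro exI[of _ F]) (auto simp: F_iff q_def)
qed

text \<open>
Codeword \<open>l\<close> is the \<open>l\<close>-th polynomial of degree at most \<open>h\<close> over the field, evaluated at all \<open>q\<close>
field elements and, in coordinate \<open>q\<close>, at infinity: there it has the coefficient of \<open>x\<^sup>h\<close>. Two
polynomials agree only at the roots of their difference, and if they also agree at infinity the
difference has degree below \<open>h\<close>. Codewords are named by natural numbers, which makes these names
usable as letters.
\<close>

lemma extended_Reed_Solomon_code:
  assumes q: "q = 2 ^ i" and "i > 0"
  shows "\<exists>C :: nat \<Rightarrow> nat \<Rightarrow> nat. (\<forall>l < q ^ Suc h. \<forall>x \<le> q. C l x < q) \<and>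
    (\<forall>l < q ^ Suc h. \<forall>l' < q ^ Suc h. l \<noteq> l' \<longrightarrow> card {x. x \<le> q \<and> C l x = C l' x} \<le> h)"
proof -
  obtain F :: "bit alg_closure set" where F: "finite F" "card F = q" "0 \<in> F"
    "\<And>x y. x \<in> F \<Longrightarrow> y \<in> F \<Longrightarrow> x + y \<in> F" "\<And>x y. x \<in> F \<Longrightarrow> y \<in> F \<Longrightarrow> x * y \<in> F"
    "1 \<in> F"
    using finite_field_power_two[OF assms(2)] unfolding q by blast
  obtain e where e: "bij_betw e {0..<q} F"
    using ex_bij_betw_nat_finite[OF F(1)] F(2) by auto
  define G where "G = {..h} \<rightarrow>\<^sub>E {..<q}"
  have "finite G" "card G = q ^ Suc h"
    by (simp_all add: G_def finite_PiE card_PiE)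
  then obtain \<phi> where \<phi>: "bij_betw \<phi> {0..<q ^ Suc h} G"
    using ex_bij_betw_nat_finite by metis
  \<comment> \<open>Field elements are named by numbers below \<open>q\<close> through \<open>e\<close>; a message \<open>g\<close> lists the coefficients.\<close>
  define P where "P g = (\<Sum>i\<le>h. Polynomial.monom (e (g i)) i)" for g
  define val where "val g x = poly (P g) (e x)" for g x
  define d where "d = the_inv_into {0..<q} e"
  define W where "W g x = (if x < q then d (val g x) else g h)" for g x
  have eF: "e x \<in> F" if "x < q" for x
    using that e by (auto simp: bij_betw_def)
  have e_inj: "x = y" if "e x = e y" "x < q" "y < q" for x y
    using that e by (auto simp: bij_betw_def inj_on_def)
  have pow: "x ^ k \<in> F" if "x \<in> F" for x k
    using that F by (induction k) auto
  have sumF: "sum f A \<in> F" if "finite A" "\<And>x. x \<in> A \<Longrightarrow> f x \<in> F" for f :: "nat \<Rightarrow> _" and A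
    using that F by (induction A rule: finite_induct) auto
  have val_F: "val g x \<in> F" if "g \<in> G" "x < q" for g x
    unfolding val_def P_def poly_sum poly_monom
    using that by (intro sumF F(5) pow eF) (auto simp: G_def PiE_iff)
  have d_less: "d y < q" and e_d: "e (d y) = y" if "y \<in> F" for y
    using that e the_inv_into_into[of e "{0..<q}" y "{0..<q}"] f_the_inv_into_f_bij_betw[OF e, of y]
    by (auto simp: d_def bij_betw_def)
  have W_less: "W g x < q" if "g \<in> G" for g x
    using that val_F d_less by (auto simp: W_def G_def PiE_iff)
  have agree: "card {x. x \<le> q \<and> W g x = W g' x} \<le> h" if "g \<in> G" "g' \<in> G" "g \<noteq> g'" for g g'
  proof -
    define D where "D = P g - P g'"
    have coeff_P: "Polynomial.coeff (P f) k = (if k \<le> h then e (f k) else 0)" for f k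
      by (auto simp: P_def coeff_sum)
    have "\<exists>k\<le>h. g k \<noteq> g' k"
      using that PiE_ext[of g "{..h}" "\<lambda>_. {..<q}" g'] by (auto simp: G_def)
    then obtain k where k: "k \<le> h" "g k \<noteq> g' k" by blast
    then have "Polynomial.coeff D k \<noteq> 0"
      using e_inj[of "g k" "g' k"] that by (auto simp: D_def coeff_P G_def PiE_iff)
    then have D: "D \<noteq> 0" by auto
    have deg: "Polynomial.degree D \<le> h"
      by (rule degree_le) (auto simp: D_def coeff_P)
    define Z where "Z = {x. x < q \<and> W g x = W g' x}"
    have "val g x = val g' x" if "x \<in> Z" for x
      using that e_d val_F \<open>g \<in> G\<close> \<open>g' \<in> G\<close> unfolding Z_def W_def by (metis (mono_tags, lifting) mem_Collect_eq)
    then have "e ` Z \<subseteq> {z. poly D z = 0}"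
      by (auto simp: D_def val_def)
    moreover have "card (e ` Z) = card Z"
      by (rule card_image) (auto simp: inj_on_def Z_def intro: e_inj)
    ultimately have Z: "card Z \<le> Polynomial.degree D"
      using card_poly_roots_bound[OF D] card_mono[OF poly_roots_finite[OF D]] by (metis order.trans)
    show ?thesis
    proof (cases "g h = g' h")
      case True
      have "Polynomial.degree D \<noteq> h"
        using D True by (metis D_def coeff_P coeff_diff diff_self leading_coeff_0_iff order_refl)
      moreover have "{x. x \<le> q \<and> W g x = W g' x} \<subseteq> insert q Z"
        by (auto simp: Z_def)
      then have "card {x. x \<le> q \<and> W g x = W g' x} \<le> card (insert q Z)"
        by (rule card_mono[rotated]) (simp add: Z_def)
      moreover have "card (insert q Z) \<le> Suc (card Z)" by (rule card_insert_le_m1) auto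
      ultimately show ?thesis using Z deg by linarith
    next
      case False
      then have "{x. x \<le> q \<and> W g x = W g' x} = Z"
        by (auto simp: Z_def W_def le_less)
      then show ?thesis using Z deg by simp
    qed
  qed
  show ?thesis
  proof (intro exI[of _ "\<lambda>l. W (\<phi> l)"] conjI allI impI)
    fix l x assume "l < q ^ Suc h"
    then show "W (\<phi> l) x < q" using W_less \<phi> by (auto simp: bij_betw_def)
  next
    fix l l' assume "l < q ^ Suc h" "l' < q ^ Suc h" "l \<noteq> l'"
    then have "\<phi> l \<in> G" "\<phi> l' \<in> G" "\<phi> l \<noteq> \<phi> l'"
      using bij_betw_apply[OF \<phi>] inj_onD[OF bij_betw_imp_inj_on[OF \<phi>], of l l'] by auto
    then show "card {x. x \<le> q \<and> W (\<phi> l) x = W (\<phi> l') x} \<le> h"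
      by (rule agree)
  qed
qed

text \<open>
Restriction to \<open>k\<close> coordinates is injective on a code with \<open>q\<^sup>k\<close> codewords in which any two distinct ones
agree in fewer than \<open>k\<close> coordinates; both sides have the same size, so it is onto.
\<close>

lemma code_interpolation:
  fixes C :: "nat \<Rightarrow> nat \<Rightarrow> nat"
  assumes range: "\<And>l x. l < q ^ k \<Longrightarrow> x \<in> U \<Longrightarrow> C l x < q"
    and dist: "\<And>l l'. l < q ^ k \<Longrightarrow> l' < q ^ k \<Longrightarrow> l \<noteq> l' \<Longrightarrow> card {x \<in> U. C l x = C l' x} < k"
    and T: "T \<subseteq> U" "card T = k" "finite U" and y: "\<And>x. x \<in> T \<Longrightarrow> y x < q"
  shows "\<exists>l < q ^ k. \<forall>x\<in>T. C l x = y x"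
proof -
  have fin: "finite T" using T finite_subset by auto
  let ?R = "\<lambda>l. restrict (C l) T"
  have inj: "inj_on ?R {..<q ^ k}"
  proof (rule inj_onI, rule ccontr)
    fix l l' assume l: "l \<in> {..<q ^ k}" "l' \<in> {..<q ^ k}" "?R l = ?R l'" "l \<noteq> l'"
    have "C l x = C l' x" if "x \<in> T" for x
      using fun_cong[OF l(3), of x] that by simp
    then have "T \<subseteq> {x \<in> U. C l x = C l' x}"
      using T(1) by auto
    then have "k \<le> card {x \<in> U. C l x = C l' x}"
      using T card_mono[of "{x \<in> U. C l x = C l' x}" T] by simp
    then show False using dist[of l l'] l by auto
  qed
  have "?R ` {..<q ^ k} = T \<rightarrow>\<^sub>E {..<q}"
  proof (rule card_subset_eq)
    show "?R ` {..<q ^ k} \<subseteq> T \<rightarrow>\<^sub>E {..<q}"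
      using range T by (auto simp: PiE_iff)
    show "card (?R ` {..<q ^ k}) = card (T \<rightarrow>\<^sub>E {..<q})"
      using fin T(2) by (simp add: card_image[OF inj] card_PiE)
  qed (simp add: fin finite_PiE)
  then have "restrict y T \<in> ?R ` {..<q ^ k}" using y by auto
  then obtain l where l: "l < q ^ k" "restrict y T = ?R l" by auto
  have "C l x = y x" if "x \<in> T" for x
    using fun_cong[OF l(2), of x] that by simp
  then show ?thesis using l(1) by auto
qed

section \<open>Words built from a code\<close>

text \<open>
For a set \<open>L\<close> of codewords, the word runs through all \<open>h\<close>-subsets of the coordinates below \<open>r\<close> and
all values on them, and inserts \<open>B L'\<close> for the set \<open>L'\<close> of codewords in \<open>L\<close> with these values. The
subsets are enumerated as in Pascal's recursion: first those that avoid the largest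
coordinate, then those that contain it, grouped by its value. The grouping is what keeps the
alternation of two letters low.
\<close>

context
  fixes C :: "'l \<Rightarrow> nat \<Rightarrow> nat" and q :: nat and B :: "'l set \<Rightarrow> 'l list"
begin

fun grid :: "nat \<Rightarrow> nat \<Rightarrow> 'l set \<Rightarrow> 'l list" where
  "grid 0 r L = B L"
| "grid (Suc h) 0 L = []"
| "grid (Suc h) (Suc r) L =
     grid (Suc h) r L @ concat (map (\<lambda>y. grid h r {l \<in> L. C l r = y}) [0..<q])"

lemma length_grid:
  assumes "\<And>L. length (B L) = M"
  shows "length (grid h r L) = (r choose h) * q ^ h * M"
  by (induction h r L rule: grid.induct)
     (simp_all add: assms length_concat o_def interv_sum_list_conv_sum_set_nat algebra_simps)

text \<open>
The set \<open>L\<close> is rich enough that after \<open>h\<close> further coordinates below \<open>r\<close> have been prescribed, every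
value of the last coordinate still occurs.
\<close>

definition interpolates :: "nat \<Rightarrow> nat \<Rightarrow> 'l set \<Rightarrow> bool" where
  "interpolates h r L \<longleftrightarrow> (\<forall>T y w. T \<subseteq> {..<r} \<and> card T = h \<and> (\<forall>x\<in>T. y x < q) \<and> w < q \<longrightarrow>
     (\<exists>l\<in>L. C l q = w \<and> (\<forall>x\<in>T. C l x = y x)))"

lemma interpolates_0: "interpolates 0 r L \<longleftrightarrow> (\<forall>w<q. \<exists>l\<in>L. C l q = w)"
proof -
  have "T \<subseteq> {..<r} \<and> card T = 0 \<longleftrightarrow> T = {}" for T
    using finite_subset[of T "{..<r}"] by auto
  then show ?thesis unfolding interpolates_def by (metis empty_iff)
qed

lemma interpolates_skip:
  assumes "interpolates h (Suc r) L"
  shows "interpolates h r L"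
proof -
  have "T \<subseteq> {..<r} \<Longrightarrow> T \<subseteq> {..<Suc r}" for T by auto
  then show ?thesis using assms unfolding interpolates_def by blast
qed

lemma interpolates_fix:
  assumes "interpolates (Suc h) (Suc r) L" "y < q"
  shows "interpolates h r {l \<in> L. C l r = y}"
  unfolding interpolates_def
proof (intro allI impI, elim conjE)
  fix T f w assume T: "T \<subseteq> {..<r}" "card T = h" "\<forall>x\<in>T. f x < q" "w < q"
  have "finite T" using T(1) finite_subset by blast
  moreover have "r \<notin> T" using T(1) by auto
  ultimately have "insert r T \<subseteq> {..<Suc r} \<and> card (insert r T) = Suc h \<and>
      (\<forall>x\<in>insert r T. (f(r := y)) x < q) \<and> w < q"
    using T assms(2) by auto
  then obtain l where "l \<in> L" "C l q = w" "\<forall>x\<in>insert r T. C l x = (f(r := y)) x"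
    using assms(1) unfolding interpolates_def by blast
  then show "\<exists>l\<in>{l \<in> L. C l r = y}. C l q = w \<and> (\<forall>x\<in>T. C l x = f x)"
    using \<open>r \<notin> T\<close> by (intro bexI[of _ l]) (auto split: if_splits)
qed

text \<open>
Induction principle for properties that survive concatenation and enlarging the set of codewords.
It is applied to the set of letters and to the colour pattern.
\<close>

lemma grid_closed:
  assumes base: "\<And>L. (\<forall>w<q. \<exists>l\<in>L. C l q = w) \<Longrightarrow> P L (B L)"
    and Nil: "\<And>L. P L []" and append: "\<And>L u v. P L u \<Longrightarrow> P L v \<Longrightarrow> P L (u @ v)"
    and mono: "\<And>L L' u. P L u \<Longrightarrow> L \<subseteq> L' \<Longrightarrow> P L' u"
    and "interpolates h r L"
  shows "P L (grid h r L)"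
  using assms(5)
proof (induction h r L rule: grid.induct)
  case (1 r L)
  then show ?case using base by (simp add: interpolates_0)
next
  case (2 h L)
  then show ?case using Nil by simp
next
  case (3 h r L)
  have "P L (concat (map (\<lambda>y. grid h r {l \<in> L. C l r = y}) ys))" if "set ys \<subseteq> {..<q}" for ys
    using that
  proof (induction ys)
    case (Cons y ys)
    then have "P {l \<in> L. C l r = y} (grid h r {l \<in> L. C l r = y})"
      using 3 by (intro "3.IH"(2) interpolates_fix) auto
    then have "P L (grid h r {l \<in> L. C l r = y})"
      by (rule mono) auto
    moreover have "P L (concat (map (\<lambda>y. grid h r {l \<in> L. C l r = y}) ys))"
      using Cons by simp
    ultimately show ?case using append by simp
  qed (simp add: Nil)
  moreover have "set [0..<q] \<subseteq> {..<q}"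
    by auto
  ultimately have "P L (concat (map (\<lambda>y. grid h r {l \<in> L. C l r = y}) [0..<q]))"
    by blast
  moreover have "P L (grid (Suc h) r L)"
    by (rule "3.IH"(1)) (rule interpolates_skip[OF "3.prems"])
  ultimately show ?case using append by simp
qed

lemma sum_list_le_single:
  assumes "distinct ys" "\<And>y. y \<in> set ys \<Longrightarrow> f y \<le> (if y = a then k else 0)"
  shows "sum_list (map f ys) \<le> (k :: nat)"
proof -
  have "sum_list (map f ys) = sum f (set ys)" using assms by (simp add: sum_list_distinct_conv_sum_set)
  also have "\<dots> \<le> (\<Sum>y\<in>set ys. if y = a then k else 0)" using assms by (intro sum_mono)
  also have "\<dots> \<le> k" by simp
  finally show ?thesis .
qed

text \<open>
Let \<open>e\<close> be the number of coordinates below \<open>r\<close> in which \<open>c\<close> and \<open>d\<close> agree. If they differ in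
coordinate \<open>r\<close>, then they lie in different groups, so the groups contribute at most two runs; the
factor \<open>2 r\<close> absorbs these. If they agree, a single group contains them, and there they have only
\<open>e\<close> agreements left out of \<open>e + 1\<close>: the first term doubles and the second follows Pascal's rule.
\<close>

lemma runs_grid:
  assumes base: "\<And>L. (\<forall>w<q. \<exists>l\<in>L. C l q = w) \<Longrightarrow> set (B L) \<subseteq> L \<and> runs c d (B L) \<le> s'"
    and "interpolates h r L"
  shows "runs c d (grid h r L) \<le>
    2 * r * 2 ^ card {x. x < r \<and> C c x = C d x} + (card {x. x < r \<and> C c x = C d x} choose h) * s'"
  using assms(2)
proof (induction h r L rule: grid.induct)
  case (1 r L)
  then have "runs c d (B L) \<le> s'" using base by (simp add: interpolates_0)
  then show ?case by simp
next
  case (2 h L)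
  then show ?case by simp
next
  case (3 h r L)
  define e where "e = card {x. x < r \<and> C c x = C d x}"
  let ?g = "\<lambda>y. grid h r {l \<in> L. C l r = y}"
  have sub: "set (?g y) \<subseteq> {l \<in> L. C l r = y}" if "y < q" for y
    using base by (intro grid_closed[where P = "\<lambda>L w. set w \<subseteq> L"] interpolates_fix[OF "3.prems" that]) auto
  have IH1: "runs c d (grid (Suc h) r L) \<le> 2 * r * 2 ^ e + (e choose Suc h) * s'"
    unfolding e_def by (rule "3.IH"(1)) (rule interpolates_skip[OF "3.prems"])
  have split: "runs c d (grid (Suc h) (Suc r) L) \<le>
       runs c d (grid (Suc h) r L) + (\<Sum>y\<leftarrow>[0..<q]. runs c d (?g y))"
    using runs_append[of c d "grid (Suc h) r L" "concat (map ?g [0..<q])"]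
      runs_concat[of c d "map ?g [0..<q]"]
    by (simp add: o_def)
  show ?case
  proof (cases "C c r = C d r")
    case True
    have "(\<Sum>y\<leftarrow>[0..<q]. runs c d (?g y)) \<le> 2 * r * 2 ^ e + (e choose h) * s'"
    proof (rule sum_list_le_single[where a = "C c r"])
      fix y assume y: "y \<in> set [0..<q]"
      show "runs c d (?g y) \<le> (if y = C c r then 2 * r * 2 ^ e + (e choose h) * s' else 0)"
      proof (cases "y = C c r")
        case False
        then have "c \<notin> set (?g y)" "d \<notin> set (?g y)" using sub[of y] y True by auto
        then show ?thesis using runs_le_of_bool[of c "?g y" d] by simp
      qed (use y "3.IH"(2)[of y] interpolates_fix[OF "3.prems", of y] in \<open>simp add: e_def\<close>)
    qed simp
    moreover have "{x. x < Suc r \<and> C c x = C d x} = insert r {x. x < r \<and> C c x = C d x}"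
      using True by (auto simp: less_Suc_eq)
    then have "card {x. x < Suc r \<and> C c x = C d x} = Suc e"
      by (simp add: e_def)
    ultimately show ?thesis using split IH1
      by (simp add: algebra_simps)
  next
    case False
    have "(\<Sum>y\<leftarrow>[0..<q]. runs c d (?g y)) \<le>
        (\<Sum>y\<leftarrow>[0..<q]. of_bool (y = C c r) + of_bool (y = C d r))"
    proof (rule sum_list_mono)
      fix y assume y: "y \<in> set [0..<q]"
      have "runs c d (?g y) \<le> of_bool (c \<in> set (?g y)) + of_bool (d \<in> set (?g y))"
        using sub[of y] y False by (intro runs_le_of_bool) auto
      also have "\<dots> \<le> of_bool (y = C c r) + of_bool (y = C d r)"
        using sub[of y] y by (intro add_mono) auto
      finally show "runs c d (?g y) \<le> of_bool (y = C c r) + of_bool (y = C d r)" .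
    qed
    also have "\<dots> = (\<Sum>y\<leftarrow>[0..<q]. of_bool (y = C c r)) + (\<Sum>y\<leftarrow>[0..<q]. of_bool (y = C d r))"
      by (rule sum_list_addf)
    also have "\<dots> \<le> 1 + 1"
      by (intro add_mono sum_list_le_single[where a = "C c r"] sum_list_le_single[where a = "C d r"]) auto
    finally have "(\<Sum>y\<leftarrow>[0..<q]. runs c d (?g y)) \<le> 2" by simp
    moreover have "(2::nat) \<le> 2 * 2 ^ e" by simp
    moreover have "2 * Suc r * 2 ^ e = 2 * r * 2 ^ e + 2 * 2 ^ e"
      by (simp add: algebra_simps)
    ultimately have "runs c d (grid (Suc h) (Suc r) L) \<le> 2 * Suc r * 2 ^ e + (e choose Suc h) * s'"
      using split IH1 by linarith
    moreover have "{x. x < Suc r \<and> C c x = C d x} = {x. x < r \<and> C c x = C d x}"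
      using False by (auto simp: less_Suc_eq)
    ultimately show ?thesis by (simp only: e_def)
  qed
qed

end

section \<open>Rainbow blocks along lines\<close>

lemma line_slope_unique:
  fixes a b a' b' u v :: nat
  assumes "u \<noteq> v" "a + b * u = a' + b' * u" "a + b * v = a' + b' * v"
  shows "b = b'"
proof -
  have "int a + int b * int u = int a' + int b' * int u"
    "int a + int b * int v = int a' + int b' * int v"
    using assms(2,3) by (metis of_nat_add of_nat_mult)+
  then have "(int b - int b') * (int u - int v) = 0"
    by (simp add: left_diff_distrib right_diff_distrib)
  then show ?thesis using assms(1) by auto
qed

text \<open>
The last coordinate of a codeword, as far as it is less than \<open>j m\<close>, encodes a point
\<open>(v, u)\<close> of a \<open>j\<close> by \<open>m\<close> array as \<open>v m + u\<close>; the colour of the letter is \<open>v\<close>. In a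
set \<open>L\<close> that realises every last coordinate, a block consists of letters on a line
\<open>u = a + b v\<close>, one for each colour. The ranges of \<open>a\<close> and \<open>b\<close> are chosen so that the line stays
in the array without any reduction modulo \<open>m\<close>, which costs only a constant factor depending on \<open>j\<close>
in the number of lines.
\<close>

context
  fixes C :: "'l \<Rightarrow> nat \<Rightarrow> nat" and q j m k :: nat
begin

definition line :: "'l set \<Rightarrow> nat \<times> nat \<Rightarrow> 'l list" where
  "line L = (\<lambda>(a, b). map (\<lambda>v. SOME l. l \<in> L \<and> C l q = v * m + (a + b * v)) [0..<j])"

definition line_blocks :: "'l set \<Rightarrow> 'l list" where
  "line_blocks L = concat (map (\<lambda>p. concat (replicate k (line L p)))
     (List.product [0..<m div 2] [0..<m div (2 * j)]))"

text \<open>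
The colours are \<open>0, 1, \<dots>, j - 1\<close> repeated. Requiring the length to be divisible by \<open>j\<close> makes this
closed under concatenation.
\<close>

definition rainbow :: "'l list \<Rightarrow> bool" where
  "rainbow w \<longleftrightarrow> j dvd length w \<and> (\<forall>i<length w. C (w ! i) q div m = i mod j)"

lemma rainbow_append:
  assumes "rainbow u" "rainbow v" shows "rainbow (u @ v)"
proof -
  obtain n where n: "length u = j * n" using assms(1) by (auto simp: rainbow_def)
  have "(i - length u) mod j = i mod j" if "length u \<le> i" for i
  proof -
    from that obtain i' where "i = length u + i'"
      by (auto simp: le_iff_add)
    then show ?thesis by (simp add: n)
  qed
  then have "C ((u @ v) ! i) q div m = i mod j" if "i < length (u @ v)" for i
    using assms that by (cases "i < length u") (simp_all add: rainbow_def nth_append)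
  then show ?thesis
    using assms by (simp add: rainbow_def)
qed

lemma rainbow_concat:
  assumes "\<And>w. w \<in> set ws \<Longrightarrow> rainbow w" shows "rainbow (concat ws)"
  using assms
proof (induction ws)
  case Nil
  then show ?case by (simp add: rainbow_def)
qed (simp add: rainbow_append)

lemma length_line [simp]: "length (line L p) = j"
  by (simp add: line_def split: prod.split)

lemma length_line_blocks: "length (line_blocks L) = (m div 2) * (m div (2 * j)) * (k * j)"
  by (simp add: line_blocks_def length_concat o_def sum_list_replicate sum_list_triv)

context
  fixes L :: "'l set"
  assumes jm: "j * m \<le> q" and L: "\<forall>w<q. \<exists>l\<in>L. C l q = w"
begin

lemma on_line_less:
  assumes "a < m div 2" "b < m div (2 * j)" "v < j"
  shows "a + b * v < m"
proof -
  have "b * v \<le> m div (2 * j) * j" using assms by (intro mult_mono) auto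
  moreover have "m div (2 * j) * (2 * j) \<le> m" by simp
  ultimately show ?thesis using assms(1) by linarith
qed

lemma nth_line:
  assumes "a < m div 2" "b < m div (2 * j)" "v < j"
  shows "line L (a, b) ! v \<in> L" "C (line L (a, b) ! v) q = v * m + (a + b * v)"
proof -
  have "v * m + (a + b * v) < Suc v * m" using on_line_less[OF assms] by simp
  also have "\<dots> \<le> j * m" using assms(3) by (intro mult_right_mono) auto
  finally have "v * m + (a + b * v) < q" using jm by linarith
  then have "\<exists>l. l \<in> L \<and> C l q = v * m + (a + b * v)" using L by blast
  from someI_ex[OF this]
  show "line L (a, b) ! v \<in> L" "C (line L (a, b) ! v) q = v * m + (a + b * v)"
    using assms(3) by (auto simp: line_def)
qed

lemma nth_line_div:
  assumes "a < m div 2" "b < m div (2 * j)" "v < j"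
  shows "C (line L (a, b) ! v) q div m = v"
  using nth_line(2)[OF assms] on_line_less[OF assms] by simp

lemma in_lineD:
  assumes "a < m div 2" "b < m div (2 * j)" "c \<in> set (line L (a, b))"
  shows "C c q mod m = a + b * (C c q div m)" "c = line L (a, b) ! (C c q div m)"
    "C c q div m < j" "c \<in> L"
proof -
  obtain v where v: "v < j" "c = line L (a, b) ! v"
    using assms(3) by (auto simp: in_set_conv_nth)
  have "C c q = v * m + (a + b * v)" "c \<in> L"
    using nth_line[OF assms(1,2) v(1)] v(2) by auto
  moreover have "C c q div m = v \<and> C c q mod m = a + b * v"
    using on_line_less[OF assms(1,2) v(1)] calculation(1) by simp
  ultimately show "C c q mod m = a + b * (C c q div m)" "c = line L (a, b) ! (C c q div m)"
    "C c q div m < j" "c \<in> L"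
    using v by auto
qed

lemma distinct_line:
  assumes "a < m div 2" "b < m div (2 * j)"
  shows "distinct (line L (a, b))"
  unfolding distinct_conv_nth
proof (intro allI impI)
  fix v v' assume v: "v < length (line L (a, b))" "v' < length (line L (a, b))" "v \<noteq> v'"
  then show "line L (a, b) ! v \<noteq> line L (a, b) ! v'"
    using nth_line_div[OF assms, of v] nth_line_div[OF assms, of v'] by force
qed

lemma set_line_blocks: "set (line_blocks L) \<subseteq> {l \<in> L. C l q < j * m}"
proof
  fix c assume "c \<in> set (line_blocks L)"
  then obtain a b where ab: "a < m div 2" "b < m div (2 * j)" "c \<in> set (line L (a, b))"
    by (auto simp: line_blocks_def)
  have "m > 0" using ab(1) by (cases m) auto
  then show "c \<in> {l \<in> L. C l q < j * m}"
    using in_lineD[OF ab] by (simp add: less_mult_imp_div_less div_less_iff_less_mult)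
qed

lemma rainbow_line_blocks: "rainbow (line_blocks L)"
proof -
  have "rainbow (line L (a, b))" if "a < m div 2" "b < m div (2 * j)" for a b
    using nth_line_div[OF that] by (simp add: rainbow_def)
  then show ?thesis
    unfolding line_blocks_def by (intro rainbow_concat) (auto intro!: rainbow_concat)
qed

text \<open>
Through a given point there is at most one line for each slope \<open>b\<close>, and two points of different colours lie
on at most one common line. Hence each letter by itself contributes at most one run for each of the
\<open>m div (2 * j)\<close> slopes, and the common line contributes at most two runs for each repetition.
\<close>

lemma runs_line_blocks:
  assumes "c \<noteq> d"
  shows "runs c d (line_blocks L) \<le> 2 * (m div (2 * j)) + 2 * k"
proof -
  define I where "I = {0..<m div 2} \<times> {0..<m div (2 * j)}"
  \<comment> \<open>the lines through the point of \<open>c\<close>\<close>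
  define N where "N c = {p \<in> I. c \<in> set (line L p)}" for c
  have [simp]: "finite I" by (simp add: I_def)
  have N_line: "C c q mod m = a + b * (C c q div m)" if "(a, b) \<in> N c" for a b c
    using that in_lineD(1) by (auto simp: N_def I_def)
  have N: "card (N c) \<le> m div (2 * j)" for c
  proof -
    have "inj_on snd (N c)"
      by (rule inj_onI) (auto dest!: N_line)
    then have "card (N c) = card (snd ` N c)" by (simp add: card_image)
    also have "\<dots> \<le> card {0..<m div (2 * j)}"
      by (intro card_mono) (auto simp: N_def I_def)
    finally show ?thesis by simp
  qed
  have both: "card (N c \<inter> N d) \<le> 1"
  proof -
    have "p = p'" if p: "p \<in> N c \<inter> N d" "p' \<in> N c \<inter> N d" for p p'
    proof -
      obtain a b a' b' where ab: "p = (a, b)" "p' = (a', b')" by (metis surj_pair)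
      let ?u = "C c q div m" and ?v = "C d q div m"
      have "?u \<noteq> ?v"
        using in_lineD(2)[of a b c] in_lineD(2)[of a b d] p assms by (auto simp: ab N_def I_def)
      moreover have "a + b * ?u = a' + b' * ?u" "a + b * ?v = a' + b' * ?v"
        using N_line p unfolding ab by (metis IntD1, metis IntD2)
      ultimately have "b = b'" by (rule line_slope_unique)
      then show ?thesis using \<open>a + b * ?u = a' + b' * ?u\<close> by (simp add: ab)
    qed
    then show ?thesis by (simp add: card_le_Suc0_iff_eq N_def)
  qed
  have block: "runs c d (concat (replicate k (line L p))) \<le>
      of_bool (p \<in> N c) + of_bool (p \<in> N d) + 2 * k * of_bool (p \<in> N c \<inter> N d)"
    if "p \<in> I" for p
  proof (cases "p \<in> N c \<inter> N d")
    case True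
    obtain a b where p: "p = (a, b)" by (cases p)
    have "runs c d (concat (replicate k (line L p))) \<le> (\<Sum>w\<leftarrow>replicate k (line L p). runs c d w)"
      by (rule runs_concat)
    also have "\<dots> \<le> k * 2"
      using runs_distinct[OF distinct_line[of a b]] that
      by (simp add: p sum_list_replicate I_def)
    finally show ?thesis using True by simp
  next
    case False
    have "runs c d (concat (replicate k (line L p))) \<le>
      of_bool (c \<in> set (concat (replicate k (line L p)))) + of_bool (d \<in> set (concat (replicate k (line L p))))"
      using False that by (intro runs_le_of_bool) (auto simp: N_def)
    also have "\<dots> \<le> of_bool (p \<in> N c) + of_bool (p \<in> N d)"
      using that by (intro add_mono) (auto simp: N_def)
    finally show ?thesis by simp
  qed
  have "runs c d (line_blocks L) \<le>
      (\<Sum>p\<leftarrow>List.product [0..<m div 2] [0..<m div (2 * j)]. runs c d (concat (replicate k (line L p))))"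
    unfolding line_blocks_def by (rule order.trans[OF runs_concat]) (simp add: o_def)
  also have "\<dots> = (\<Sum>p\<in>I. runs c d (concat (replicate k (line L p))))"
    by (subst sum_list_distinct_conv_sum_set) (auto simp: distinct_product I_def)
  also have "\<dots> \<le> (\<Sum>p\<in>I. of_bool (p \<in> N c) + of_bool (p \<in> N d) + 2 * k * of_bool (p \<in> N c \<inter> N d))"
    by (rule sum_mono) (rule block)
  also have "\<dots> = card (N c) + card (N d) + 2 * k * card (N c \<inter> N d)"
  proof -
    have "(\<Sum>p\<in>I. of_bool (p \<in> M)) = card M" if "M \<subseteq> I" for M
      using that by (simp add: Int_absorb1)
    moreover have "N c \<subseteq> I" "N d \<subseteq> I" "N c \<inter> N d \<subseteq> I"
      by (auto simp: N_def)
    ultimately show ?thesis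
      by (simp add: sum.distrib sum_distrib_left[symmetric] del: sum_of_bool_eq Int_iff)
  qed
  also have "\<dots> \<le> m div (2 * j) + m div (2 * j) + 2 * k * 1"
    by (intro add_mono N mult_left_mono both) simp
  finally show ?thesis by simp
qed

end
end

section \<open>A sparse sequence with few alternations\<close>

text \<open>
Equal letters are at distance at least \<open>j\<close>. This implies \<open>j_sparse j w\<close>, and in contrast to it also
says something about words shorter than \<open>j\<close>; for \<open>j \<ge> 2\<close> it excludes equal neighbours.
\<close>

definition spread :: "nat \<Rightarrow> 'a list \<Rightarrow> bool" where
  "spread j w \<longleftrightarrow> (\<forall>i i'. i < i' \<and> i' < length w \<and> i' < i + j \<longrightarrow> w ! i \<noteq> w ! i')"

lemma rainbow_imp_spread:
  assumes "rainbow C q j m w" shows "spread j w"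
  unfolding spread_def
proof (intro allI impI notI; elim conjE)
  fix i i' assume i: "i < i'" "i' < length w" "i' < i + j" "w ! i = w ! i'"
  then have "i mod j = i' mod j"
    using assms by (metis less_trans rainbow_def)
  then have "j dvd i' - i" using i(1) by (metis less_imp_le mod_eq_dvd_iff_nat)
  then show False using i by (auto dest: dvd_imp_le)
qed

lemma spread_append_fresh:
  assumes "spread j w" "distinct z" "set w \<inter> set z = {}"
  shows "spread j (w @ z)"
  unfolding spread_def
proof (intro allI impI; elim conjE)
  fix i i' assume i: "i < i'" "i' < length (w @ z)" "i' < i + j"
  consider "i' < length w" | "i < length w" "length w \<le> i'" | "length w \<le> i" by linarith
  then show "(w @ z) ! i \<noteq> (w @ z) ! i'"
  proof cases
    case 1
    then show ?thesis using i assms(1) by (simp add: nth_append spread_def)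
  next
    case 2
    then have "(w @ z) ! i \<in> set w" "(w @ z) ! i' \<in> set z" using i by (auto simp: nth_append)
    then show ?thesis using assms(3) by auto
  next
    case 3
    then show ?thesis using i assms(2) by (simp add: nth_append nth_eq_iff_index_eq)
  qed
qed

lemma spread_imp_j_sparse: "spread j w \<Longrightarrow> j_sparse j w"
  unfolding j_sparse_def
proof (intro allI impI; elim conjE)
  fix u assume w: "spread j w" and u: "sublist u w" "length u = j"
  from u(1) obtain x y where xy: "w = x @ u @ y" by (auto simp: sublist_def)
  show "distinct u"
  proof (rule ccontr)
    assume "\<not> distinct u"
    then obtain i i' where i: "i < i'" "i' < length u" "u ! i = u ! i'"
      unfolding distinct_conv_nth by (metis linorder_neqE_nat)
    have "w ! (length x + i) = u ! i" "w ! (length x + i') = u ! i'"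
      using i by (auto simp: xy nth_append)
    moreover have "w ! (length x + i) \<noteq> w ! (length x + i')"
      using w[unfolded spread_def, rule_format, of "length x + i" "length x + i'"] i u(2)
      by (simp add: xy del: nth_append_length_plus)
    ultimately show False using i by simp
  qed
qed

lemma spread_imp_distinct_adj:
  assumes "spread j w" "j \<ge> 2" shows "distinct_adj w"
  unfolding distinct_adj_conv_nth using assms by (auto simp: spread_def)

lemma length_le_DS_maxI:
  fixes w :: "nat list"
  assumes "w \<in> DS n s" "j_sparse j w" "s \<ge> 1"
  shows "length w \<le> DS_max s n j"
  unfolding DS_max_def
proof (rule Max_ge)
  have "{length w |w :: nat list. w \<in> DS n s \<and> j_sparse j w} \<subseteq> {..n ^ 2 * s}"
    using length_DS_le assms(3) by auto
  then show "finite {length w |w :: nat list. w \<in> DS n s \<and> j_sparse j w}"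
    by (rule finite_subset) simp
qed (use assms in auto)

text \<open>
A sequence with exactly \<open>n\<close> letters is obtained by appending unused letters once each.
The appended part adds at most two runs for any pair, whence the margin in the bound on \<open>runs\<close>.
\<close>

lemma spread_length_le_DS_max:
  fixes w :: "nat list"
  assumes w: "spread j w" "card (set w) \<le> n" and runs: "\<And>a b. a \<noteq> b \<Longrightarrow> runs a b w + 1 \<le> s"
    and "j \<ge> 2"
  shows "length w \<le> DS_max s n j"
proof -
  obtain Z where Z: "Z \<subseteq> - set w" "finite Z" "card Z = n - card (set w)"
    by (metis infinite_arbitrarily_large finite_compl finite_set infinite_UNIV_nat)
  obtain z where z: "set z = Z" "distinct z" using finite_distinct_list[OF Z(2)] by blast
  have "davenport_schinzel s (w @ z)"
    unfolding davenport_schinzel_def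
  proof (intro conjI allI impI notI)
    show "distinct_adj (w @ z)"
      using spread_append_fresh[of j w z] assms z Z by (intro spread_imp_distinct_adj[of j]) auto
    fix a b assume ab: "a \<noteq> b" "subseq (alternation a b (s + 2)) (w @ z)"
    have "s + 2 \<le> runs a b (w @ z)" using alternation_le_runs[OF ab] .
    also have "\<dots> \<le> runs a b w + 2"
      using runs_append[of a b w z] runs_distinct[OF z(2), of a b] by linarith
    finally show False using runs[OF ab(1)] by simp
  qed
  moreover have "card (set (w @ z)) = n"
    using Z z w(2) by (subst set_append, subst card_Un_disjoint) auto
  moreover have "j_sparse j (w @ z)"
    using spread_append_fresh[of j w z] assms z Z by (intro spread_imp_j_sparse) auto
  moreover have "s \<ge> 1" using runs[of 0 1] by simp
  ultimately have "length (w @ z) \<le> DS_max s n j"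
    by (intro length_le_DS_maxI) (auto simp: DS_def)
  then show ?thesis by simp
qed

text \<open>
The word has \<open>q choose h\<close> times \<open>q ^ h\<close> families, each with \<open>(m div 2) * (m div (2 * j))\<close> lines of
\<open>j\<close> letters repeated \<open>k\<close> times. Only letters with last coordinate below \<open>j * m\<close> occur, so there are at
most \<open>j * m * q ^ h\<close> of them. Two distinct letters have \<open>e \<le> h\<close> agreements, so that
\<open>e choose h\<close> is at most one: the pair shares at most one family.
\<close>

lemma DS_max_ge_grid:
  assumes q: "q = 2 ^ i" "i > 0" and h: "h \<le> q" and j: "j \<ge> 2" and m: "j * m \<le> q"
    and n: "j * m * q ^ h \<le> n" and s: "2 * q * 2 ^ h + (2 * (m div (2 * j)) + 2 * k) + 1 \<le> s"
  shows "(q choose h) * q ^ h * ((m div 2) * (m div (2 * j)) * (k * j)) \<le> DS_max s n j"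
proof -
  obtain C :: "nat \<Rightarrow> nat \<Rightarrow> nat" where
    range: "\<And>l x. l < q ^ Suc h \<Longrightarrow> x \<le> q \<Longrightarrow> C l x < q" and
    agree: "\<And>l l'. l < q ^ Suc h \<Longrightarrow> l' < q ^ Suc h \<Longrightarrow> l \<noteq> l' \<Longrightarrow>
       card {x. x \<le> q \<and> C l x = C l' x} \<le> h"
    using extended_Reed_Solomon_code[OF q, of h] by blast
  define B where "B = line_blocks C q j m k"
  define L where "L = {..<q ^ Suc h}"
  define w where "w = grid C q B h q L"
  have interpolates: "interpolates C q h q L"
    unfolding interpolates_def
  proof (intro allI impI; elim conjE)
    fix T y u assume T: "T \<subseteq> {..<q}" "card T = h" "\<forall>x\<in>T. y x < q" "u < q"
    have "finite T" "q \<notin> T" using T(1) finite_subset by auto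
    have "\<exists>l < q ^ Suc h. \<forall>x\<in>insert q T. C l x = (y(q := u)) x"
    proof (rule code_interpolation)
      show "card {x \<in> {..q}. C l x = C l' x} < Suc h" if "l < q ^ Suc h" "l' < q ^ Suc h" "l \<noteq> l'" for l l'
        using agree[OF that] by (simp add: less_Suc_eq_le)
      show "insert q T \<subseteq> {..q}" "card (insert q T) = Suc h"
        using T \<open>finite T\<close> \<open>q \<notin> T\<close> by auto
    qed (use range T \<open>q \<notin> T\<close> in auto)
    then show "\<exists>l\<in>L. C l q = u \<and> (\<forall>x\<in>T. C l x = y x)"
      using \<open>q \<notin> T\<close> unfolding L_def by (metis fun_upd_apply insertCI lessThan_iff)
  qed
  have "rainbow C q j m w"
    unfolding w_def
  proof (rule grid_closed[where P = "\<lambda>_. rainbow C q j m"])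
    show "rainbow C q j m (B L)" if "\<forall>w<q. \<exists>l\<in>L. C l q = w" for L
      unfolding B_def using that by (rule rainbow_line_blocks[OF m])
  qed (auto simp: interpolates rainbow_append, simp add: rainbow_def)
  then have "spread j w" by (rule rainbow_imp_spread)
  moreover have set_w: "set w \<subseteq> {l \<in> L. C l q < j * m}"
    unfolding w_def
  proof (rule grid_closed[where P = "\<lambda>L w. set w \<subseteq> {l \<in> L. C l q < j * m}"])
    show "set (B L) \<subseteq> {l \<in> L. C l q < j * m}" if "\<forall>w<q. \<exists>l\<in>L. C l q = w" for L
      unfolding B_def using that by (rule set_line_blocks[OF m])
  qed (use interpolates in auto)
  have "card (set w) \<le> n"
  proof -
    let ?f = "\<lambda>l. (C l q, restrict (C l) {..<h})"
    have "inj_on ?f L"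
    proof (rule inj_onI, rule ccontr)
      fix l l' assume l: "l \<in> L" "l' \<in> L" "?f l = ?f l'" "l \<noteq> l'"
      have "C l x = C l' x" if "x \<in> insert q {..<h}" for x
        using l(3) that by auto (metis lessThan_iff restrict_apply')
      then have "insert q {..<h} \<subseteq> {x. x \<le> q \<and> C l x = C l' x}" using h by auto
      then have "card (insert q {..<h}) \<le> card {x. x \<le> q \<and> C l x = C l' x}"
        by (intro card_mono) auto
      also have "\<dots> \<le> h" using agree l by (simp add: L_def)
      finally show False using h by simp
    qed
    then have "card (set w) = card (?f ` set w)"
      using set_w by (intro card_image[symmetric]) (auto intro: inj_on_subset)
    also have "\<dots> \<le> card ({..<j * m} \<times> ({..<h} \<rightarrow>\<^sub>E {..<q}))"
      using set_w range h by (intro card_mono) (auto simp: L_def finite_PiE split: if_splits)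
    also have "\<dots> = j * m * q ^ h" by (simp add: card_cartesian_product card_PiE)
    finally show ?thesis using n by simp
  qed
  moreover have "runs c d w + 1 \<le> s" if "c \<noteq> d" for c d
  proof (cases "c \<in> set w \<and> d \<in> set w")
    case True
    define e where "e = card {x. x < q \<and> C c x = C d x}"
    have "e \<le> card {x. x \<le> q \<and> C c x = C d x}"
      unfolding e_def by (intro card_mono) auto
    also have "\<dots> \<le> h" using agree[of c d] True set_w that by (auto simp: L_def)
    finally have "e \<le> h" .
    have "runs c d w \<le> 2 * q * 2 ^ e + (e choose h) * (2 * (m div (2 * j)) + 2 * k)"
      unfolding w_def e_def
    proof (rule runs_grid[OF _ interpolates])
      fix L assume "\<forall>w<q. \<exists>l\<in>L. C l q = w"
      then show "set (B L) \<subseteq> L \<and> runs c d (B L) \<le> 2 * (m div (2 * j)) + 2 * k"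
        unfolding B_def using set_line_blocks[OF m, of L] runs_line_blocks[OF m _ that, of L] by blast
    qed
    also have "\<dots> \<le> 2 * q * 2 ^ h + 1 * (2 * (m div (2 * j)) + 2 * k)"
    proof (intro add_mono mult_mono)
      show "e choose h \<le> 1" using \<open>e \<le> h\<close> by (cases "e = h") (auto simp: binomial_eq_0)
    qed (use \<open>e \<le> h\<close> in auto)
    finally have "runs c d w + 1 \<le> 2 * q * 2 ^ h + (2 * (m div (2 * j)) + 2 * k) + 1" by simp
    then show ?thesis using s by (rule order.trans)
  next
    case False
    then have "runs c d w \<le> 1" using runs_le_of_bool[of c w d] by (auto split: if_splits simp: of_bool_def)
    moreover have "1 \<le> 2 * q * 2 ^ h" using q by simp
    ultimately show ?thesis using s by linarith
  qed
  ultimately have "length w \<le> DS_max s n j"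
    using j by (intro spread_length_le_DS_max) auto
  then show ?thesis by (simp add: w_def B_def length_grid[OF length_line_blocks])
qed

section \<open>Choice of the parameters\<close>

text \<open>
Bernoulli's inequality: \<open>h!\<close> times the binomial coefficient is at least \<open>(q - h) ^ h\<close>, and
\<open>(1 - h / q) ^ h \<ge> 1 - h\<^sup>2 / q\<close>.
\<close>

lemma power_le_two_fact_binomial:
  assumes "2 * h ^ 2 \<le> q"
  shows "real q ^ h \<le> 2 * (fact h * real (q choose h))"
proof (cases "h = 0")
  case False
  have hq: "h \<le> q" using assms False by (metis le_square le_trans mult_2 power2_eq_square trans_le_add1)
  then have q: "real q > 0" using False by simp
  have "real q ^ h * (1 / 2) \<le> real q ^ h * (1 + real h * (- real h / real q))"
  proof (rule mult_left_mono)
    have "2 * real h ^ 2 \<le> real q" using assms by (metis of_nat_le_iff of_nat_mult of_nat_numeral of_nat_power)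
    then show "1 / 2 \<le> 1 + real h * (- real h / real q)"
      using q by (simp add: field_simps power2_eq_square)
  qed simp
  also have "\<dots> \<le> real q ^ h * (1 + - real h / real q) ^ h"
    using hq q by (intro mult_left_mono Bernoulli_inequality) (auto simp: field_simps)
  also have "\<dots> = (\<Prod>i = 0..<h. real q - real h)"
    using q by (simp add: power_mult_distrib[symmetric] field_simps)
  also have "\<dots> \<le> (\<Prod>i = 0..<h. real q - real i)"
    using hq by (intro prod_mono) auto
  also have "\<dots> = fact h * real (q choose h)"
    by (simp add: binomial_gbinomial gbinomial_prod_rev)
  finally show ?thesis by simp
qed simp

text \<open>
With \<open>Q\<close> the \<open>(h + 1)\<close>-th root of \<open>n\<close>, the parameters are a power of two \<open>q\<close> with \<open>Q < q \<le> 2 Q\<close>,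
\<open>m = n div (j * q ^ h)\<close> and \<open>k = s div 8\<close>. The hypothesis on \<open>n\<close> says \<open>Q \<ge> h ^ h\<close>, which is
large enough for \<open>m \<ge> 4 j\<close>, so rounding loses only constant factors. The hypothesis
\<open>2 ^ (h + 4) \<le> c * fact h\<close> gives \<open>2 ^ (h + 4) * Q \<le> s\<close>, so that the runs outside common blocks use
up at most half of \<open>s\<close>. The factor 2048 is 512, from the four roundings 2, 4, 4 and 16, times
\<open>2\<^sup>2\<close> from \<open>m\<close>.
\<close>

lemma DS_max_ge_large_n:
  fixes c :: real
  assumes j: "j \<ge> 2"
    and h: "2 ^ (h + 4) \<le> c * fact h" "4 * j ^ 2 * 2 ^ h \<le> h ^ h" "2 * h ^ 2 \<le> h ^ h" "h \<ge> 2"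
    and n: "h ^ (h * (h + 1)) \<le> n"
    and s: "c * (real n powr (1 / real (h + 1)) * fact h) \<le> real s"
  shows "real n ^ 2 * real s / (2048 * real j ^ 2 * fact h) \<le> real (DS_max s n j)"
proof -
  define Q where "Q = real n powr (1 / real (h + 1))"
  have "h ^ (h * (h + 1)) > 0" using h(4) by simp
  then have "n > 0" using n by linarith
  then have "Q > 0" by (simp add: Q_def)
  have "Q ^ (h + 1) = Q powr real (h + 1)"
    using \<open>Q > 0\<close> by (rule powr_realpow[symmetric])
  also have "\<dots> = real n"
    using \<open>n > 0\<close> unfolding Q_def powr_powr by simp
  finally have Q_pow: "Q ^ (h + 1) = real n" .
  have Q_ge: "real (h ^ h) \<le> Q"
  proof (rule power_le_imp_le_base)
    have "real (h ^ h) ^ Suc h = real (h ^ (h * (h + 1)))"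
      by (simp add: power_mult[symmetric] del: power_Suc)
    also have "\<dots> \<le> real n" using n by simp
    finally show "real (h ^ h) ^ Suc h \<le> Q ^ Suc h" using Q_pow by simp
  qed (use \<open>Q > 0\<close> in auto)
  have "1 \<le> h ^ h" using h(4) by simp
  then have "Q \<ge> 1" using Q_ge by linarith
  then have "nat \<lfloor>Q\<rfloor> \<ge> 1" by (simp add: le_nat_floor)
  then obtain a where a: "2 ^ a \<le> nat \<lfloor>Q\<rfloor>" "nat \<lfloor>Q\<rfloor> < 2 ^ (a + 1)"
    using ex_power_ivl1[of 2 "nat \<lfloor>Q\<rfloor>"] by auto
  define q :: nat where "q = 2 ^ (a + 1)"
  have "real (2 ^ a) \<le> Q" using a(1) \<open>Q > 0\<close> by (simp add: le_nat_floor le_floor_iff nat_le_iff le_nat_iff)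
  then have q_le: "real q \<le> 2 * Q" by (simp add: q_def)
  have "Q < real (nat \<lfloor>Q\<rfloor>) + 1" using \<open>Q > 0\<close> by linarith
  also have "\<dots> \<le> real q" using a(2) unfolding q_def by linarith
  finally have Q_less: "Q < real q" .
  have q_pos: "q > 0" by (simp add: q_def)
  have hq: "2 * h ^ 2 \<le> q" using Q_ge Q_less h(3) by linarith
  have "h \<le> q" using hq by (metis le_square le_trans mult_2 power2_eq_square trans_le_add1)
  define m where "m = n div (j * q ^ h)"
  have jmq: "j * m * q ^ h \<le> n"
    unfolding m_def by (metis div_times_less_eq_dividend mult.assoc mult.commute)
  have "real n \<le> real q ^ (h + 1)"
    using Q_pow Q_less \<open>Q > 0\<close> by (metis less_imp_le power_mono)
  then have "n \<le> q ^ (h + 1)" by (metis of_nat_le_iff of_nat_power)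
  then have jm: "j * m \<le> q" using order.trans[OF jmq \<open>n \<le> q ^ (h + 1)\<close>] q_pos by simp
  have "4 * j * (j * q ^ h) \<le> n"
  proof -
    have "real (4 * j * (j * q ^ h)) = 4 * real j ^ 2 * real q ^ h"
      by (simp add: power2_eq_square)
    also have "\<dots> \<le> 4 * real j ^ 2 * (2 * Q) ^ h"
      using q_le by (intro mult_left_mono power_mono) auto
    also have "\<dots> = real (4 * j ^ 2 * 2 ^ h) * Q ^ h" by (simp add: power_mult_distrib)
    also have "\<dots> \<le> Q * Q ^ h"
    proof (rule mult_right_mono)
      have "real (4 * j ^ 2 * 2 ^ h) \<le> real (h ^ h)" using h(2) by (simp only: of_nat_le_iff)
      then show "real (4 * j ^ 2 * 2 ^ h) \<le> Q" using Q_ge by linarith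
    qed (use \<open>Q > 0\<close> in simp)
    finally have "real (4 * j * (j * q ^ h)) \<le> real n" using Q_pow by simp
    then show ?thesis by (simp only: of_nat_le_iff)
  qed
  then have m_ge: "4 * j \<le> m"
    unfolding m_def using j q_pos by (simp add: less_eq_div_iff_mult_less_eq)
  have n_le: "real n \<le> 2 * real j * real q ^ h * real m"
  proof -
    have "n < (m + 1) * (j * q ^ h)"
      unfolding m_def using j q_pos by (simp add: dividend_less_div_times add.commute)
    also have "\<dots> \<le> (2 * m) * (j * q ^ h)" using m_ge j by (intro mult_right_mono) auto
    finally have "real n \<le> real ((2 * m) * (j * q ^ h))" by (simp only: of_nat_le_iff less_imp_le)
    then show ?thesis by (simp add: algebra_simps)
  qed
  define k where "k = s div 8"
  have s_ge: "2 ^ (h + 4) * Q \<le> real s"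
  proof -
    have "2 ^ (h + 4) * Q \<le> c * fact h * Q" using h(1) \<open>Q > 0\<close> by (intro mult_right_mono) auto
    also have "\<dots> \<le> real s" using s by (simp add: Q_def mult_ac)
    finally show ?thesis .
  qed
  have "(16::real) * 1 \<le> 2 ^ (h + 4) * Q"
    using \<open>Q \<ge> 1\<close> by (intro mult_mono) (auto simp: power_add)
  then have "s \<ge> 16" using s_ge by linarith
  have "2 * q * 2 ^ h + (2 * (m div (2 * j)) + 2 * k) + 1 \<le> s"
  proof -
    have "real (2 ^ (h + 3) * q) \<le> 2 ^ (h + 3) * (2 * Q)"
      using q_le by simp
    also have "\<dots> \<le> real s"
      using s_ge by (simp add: power_add)
    finally have "real (2 ^ (h + 3) * q) \<le> real s" .
    then have "2 ^ (h + 3) * q \<le> s" by (simp only: of_nat_le_iff)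
    then have "8 * (2 ^ h * q) \<le> s" by (simp add: power_add)
    moreover have "2 * (m div (2 * j)) \<le> q"
    proof -
      have "2 * (m div (2 * j)) \<le> 2 * j * (m div (2 * j))" using j by (intro mult_right_mono) auto
      also have "\<dots> \<le> j * m" using j by (metis div_times_less_eq_dividend le_trans mult.commute mult_le_mono1 mult_1 le_numeral_extra(4) one_le_numeral)
      finally show ?thesis using jm by linarith
    qed
    moreover have "q \<le> 2 ^ h * q" by simp
    moreover have "4 * (2 * k) \<le> s" unfolding k_def by simp
    moreover have "q \<ge> 1" using q_pos by simp
    moreover have "2 * q * 2 ^ h = 2 * (2 ^ h * q)" by simp
    ultimately show ?thesis by linarith
  qed
  from DS_max_ge_grid[OF q_def _ \<open>h \<le> q\<close> j jm jmq this]
  have "(q choose h) * q ^ h * ((m div 2) * (m div (2 * j)) * (k * j)) \<le> DS_max s n j" by simp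
  then have *: "real (q choose h) * real q ^ h * (real (m div 2) * real (m div (2 * j)) * (real k * real j))
     \<le> real (DS_max s n j)"
    by (metis of_nat_le_iff of_nat_mult of_nat_power)
  have 1: "real q ^ h / (2 * fact h) \<le> real (q choose h)"
    using power_le_two_fact_binomial[OF hq] by (simp add: field_simps)
  have 2: "real m / 4 \<le> real (m div 2)" using m_ge j by linarith
  have 3: "real m / (4 * real j) \<le> real (m div (2 * j))"
  proof -
    define d where "d = m div (2 * j)"
    have "d \<ge> 1" unfolding d_def using m_ge j by (simp add: less_eq_div_iff_mult_less_eq)
    have "m < (d + 1) * (2 * j)"
      unfolding d_def using j by (simp add: dividend_less_div_times add.commute)
    also have "\<dots> \<le> (2 * d) * (2 * j)" using \<open>d \<ge> 1\<close> by (intro mult_right_mono) auto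
    finally have "real m \<le> real ((2 * d) * (2 * j))" by (simp only: of_nat_le_iff less_imp_le)
    then show ?thesis unfolding d_def[symmetric] using j by (simp add: field_simps)
  qed
  have 4: "real s / 16 \<le> real k" unfolding k_def using \<open>s \<ge> 16\<close> by linarith
  have "real n ^ 2 * real s / (2048 * real j ^ 2 * fact h) \<le>
      (2 * real j * real q ^ h * real m) ^ 2 * real s / (2048 * real j ^ 2 * fact h)"
    using n_le by (intro divide_right_mono mult_right_mono power_mono) auto
  also have "\<dots> = real q ^ h / (2 * fact h) * real q ^ h *
      (real m / 4 * (real m / (4 * real j)) * (real s / 16 * real j))"
    using j by (simp add: field_simps power2_eq_square)
  also have "\<dots> \<le> real (q choose h) * real q ^ h * (real (m div 2) * real (m div (2 * j)) * (real k * real j))"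
    by (intro mult_mono 1 2 3 4) auto
  finally show ?thesis using * by linarith
qed

lemma eventually_admissible:
  fixes c :: real
  assumes "c > 0"
  shows "\<exists>H. \<forall>h\<ge>H. 2 ^ (h + 4) \<le> c * fact h \<and> 4 * j ^ 2 * 2 ^ h \<le> h ^ h \<and> 2 * h ^ 2 \<le> h ^ h \<and> h \<ge> 2"
proof -
  have lim: "(\<lambda>h. 2 ^ h / fact h :: real) \<longlonglongrightarrow> 0"
    using summable_LIMSEQ_zero[OF summable_exp[of 2]] by (simp add: field_simps)
  have ev: "\<forall>\<^sub>F h in sequentially. 2 ^ h * K \<le> (d * fact h :: real)" if "d > 0" "K > 0" for d K
  proof -
    have "\<forall>\<^sub>F h in sequentially. 2 ^ h / fact h < d / K"
      using lim that by (intro order_tendstoD) auto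
    then show ?thesis
      by eventually_elim (use that in \<open>simp add: field_simps\<close>)
  qed
  have "\<forall>\<^sub>F h in sequentially. 2 ^ (h + 4) \<le> c * fact h"
    using ev[OF assms, of 16] by (simp add: power_add)
  moreover have "\<forall>\<^sub>F h in sequentially. 4 * j ^ 2 * 2 ^ h \<le> h ^ h"
  proof -
    have "4 * j ^ 2 * 2 ^ h \<le> h ^ h" if "2 ^ h * (4 * real j ^ 2 + 1) \<le> 1 * fact h" for h
    proof -
      have "real (4 * j ^ 2 * 2 ^ h) \<le> 2 ^ h * (4 * real j ^ 2 + 1)"
        by (simp add: algebra_simps)
      also have "\<dots> \<le> real (fact h)" using that by simp
      also have "\<dots> \<le> real (h ^ h)" using fact_le_power[of h, where 'a = nat] by (simp only: of_nat_le_iff) simp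
      finally show ?thesis by (simp only: of_nat_le_iff)
    qed
    moreover have "0 < 4 * real j ^ 2 + 1" by (simp add: add_nonneg_pos)
    ultimately show ?thesis using eventually_mono[OF ev[of 1 "4 * real j ^ 2 + 1"]] by auto
  qed
  moreover have "\<forall>\<^sub>F h in sequentially. h \<ge> (3::nat)"
    by (rule eventually_ge_at_top)
  ultimately have "\<forall>\<^sub>F h in sequentially. 2 ^ (h + 4) \<le> c * fact h \<and> 4 * j ^ 2 * 2 ^ h \<le> h ^ h \<and> h \<ge> 3"
    by eventually_elim auto
  then obtain H where H: "\<And>h. h \<ge> H \<Longrightarrow> 2 ^ (h + 4) \<le> c * fact h \<and> 4 * j ^ 2 * 2 ^ h \<le> h ^ h \<and> h \<ge> 3"
    by (auto simp: eventually_sequentially)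
  moreover have "2 * h ^ 2 \<le> h ^ h" if "h \<ge> 3" for h :: nat
  proof -
    have "2 * h ^ 2 \<le> h * h ^ 2" using that by (intro mult_right_mono) auto
    also have "\<dots> = h ^ 3" by (simp add: power3_eq_cube power2_eq_square)
    also have "\<dots> \<le> h ^ h" using that by (intro power_increasing) auto
    finally show ?thesis .
  qed
  ultimately show ?thesis by (intro exI[of _ H]) force
qed

lemma powr_inverse_Suc:
  fixes x :: real
  assumes "h \<ge> 1"
  shows "x powr (1 / real h) = x powr (1 / real (h * (h + 1))) * x powr (1 / real (h + 1))"
proof -
  have "1 / real h - 1 / real (h + 1) = 1 / real (h * (h + 1))"
    using assms by (subst diff_frac_eq) (auto simp: algebra_simps)
  then have "1 / real h = 1 / real (h * (h + 1)) + 1 / real (h + 1)"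
    by linarith
  then show ?thesis by (simp only: powr_add)
qed

lemma powr_inverse_power:
  assumes "k \<ge> 1"
  shows "real (b ^ k) powr (1 / real k) = real b"
proof (cases "b = 0")
  case False
  then show ?thesis using assms by (simp add: powr_realpow[symmetric] powr_powr)
qed (use assms in simp)

lemma powr_inverse_le:
  assumes "h \<ge> 1" "n \<le> b ^ (h * (h + 1))"
  shows "real n powr (1 / real h) \<le> real b * real n powr (1 / real (h + 1))"
proof -
  have "real n powr (1 / real (h * (h + 1))) \<le> real (b ^ (h * (h + 1))) powr (1 / real (h * (h + 1)))"
    using assms by (intro powr_mono2) auto
  also have "\<dots> = real b" using assms by (intro powr_inverse_power) simp
  finally show ?thesis
    unfolding powr_inverse_Suc[OF assms(1), of "real n"] by (intro mult_right_mono) auto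
qed

lemma powr_inverse_ge:
  assumes "h \<ge> 1" "b ^ (h * (h + 1)) \<le> n"
  shows "real b * real n powr (1 / real (h + 1)) \<le> real n powr (1 / real h)"
proof -
  have "real b = real (b ^ (h * (h + 1))) powr (1 / real (h * (h + 1)))"
    using assms by (intro powr_inverse_power[symmetric]) simp
  also have "\<dots> \<le> real n powr (1 / real (h * (h + 1)))"
    using assms by (intro powr_mono2) auto
  finally show ?thesis
    unfolding powr_inverse_Suc[OF assms(1), of "real n"] by (intro mult_right_mono) auto
qed

text \<open>
Here \<open>h + 1\<close> is the exponent \<open>t\<close>, and \<open>wide\<close> is the bound in the range where \<open>n\<close> is large compared
with \<open>h\<close>. Outside that range the root of \<open>n\<close> grows by a factor of at most \<open>h\<close> when its order drops from
\<open>h + 1\<close> to \<open>h\<close>, while the factorial shrinks by exactly \<open>h\<close>; so the hypothesis on \<open>s\<close> passes from \<open>h\<close>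
to \<open>h - 1\<close>, where the conclusion is stronger. For \<open>h < H\<close> the root of order \<open>H + 1\<close> is so much
smaller than that of order \<open>h + 1\<close> that it compensates \<open>H!\<close>, and the hypothesis passes to \<open>H\<close>.
\<close>

lemma lower_bound_all_exponents:
  fixes c K D :: real and n s h :: nat
  assumes c: "c > 0" and H: "H \<ge> 2"
   and wide: "\<And>h. h \<ge> H \<Longrightarrow> h ^ (h * (h + 1)) \<le> n \<Longrightarrow>
      c * (real n powr (1 / real (h + 1)) * fact h) \<le> real s \<Longrightarrow>
      real n ^ 2 * real s / (K * fact h) \<le> D"
   and K: "K > 0"
   and n: "(H ^ H) ^ (H * (H + 1)) \<le> n"
   and s: "c * (real n powr (1 / real (h + 1)) * fact h) \<le> real s"
  shows "real n ^ 2 * real s / (K * fact H * fact h) \<le> D"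
proof -
  have base: "H ^ (H * (H + 1)) \<le> n"
  proof -
    have "H ^ 1 \<le> H ^ H" using H by (intro power_increasing) auto
    then have "H ^ (H * (H + 1)) \<le> (H ^ H) ^ (H * (H + 1))" by (intro power_mono) auto
    then show ?thesis using n by linarith
  qed
  have large: "real n ^ 2 * real s / (K * fact h) \<le> D"
    if "H \<le> h" "c * (real n powr (1 / real (h + 1)) * fact h) \<le> real s" for h
    using that
  proof (induction h rule: nat_induct_at_least)
    case base
    then show ?case using wide[of H] \<open>H ^ (H * (H + 1)) \<le> n\<close> by simp
  next
    case (Suc h)
    show ?case
    proof (cases "Suc h ^ (Suc h * (Suc h + 1)) \<le> n")
      case True
      then show ?thesis using wide[of "Suc h"] Suc by simp
    next
      case False
      then have "real n powr (1 / real (h + 1)) \<le> real (Suc h) * real n powr (1 / real (Suc h + 1))"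
        using powr_inverse_le[of "Suc h" n "Suc h"] by simp
      then have "c * (real n powr (1 / real (h + 1)) * fact h) \<le>
          c * ((real (Suc h) * real n powr (1 / real (Suc h + 1))) * fact h)"
        using c by (intro mult_left_mono mult_right_mono) auto
      also have "\<dots> \<le> real s" using Suc.prems by (simp add: algebra_simps)
      finally have "real n ^ 2 * real s / (K * fact h) \<le> D" by (rule Suc.IH)
      moreover have "real n ^ 2 * real s / (K * fact (Suc h)) \<le> real n ^ 2 * real s / (K * fact h)"
        using K by (intro divide_left_mono mult_left_mono fact_mono) auto
      ultimately show ?thesis by linarith
    qed
  qed
  show ?thesis
  proof (cases "H \<le> h")
    case True
    have "real n ^ 2 * real s / (K * fact H * fact h) \<le> real n ^ 2 * real s / (K * fact h)"
    proof (rule divide_left_mono)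
      have "K * 1 * fact h \<le> K * fact H * fact h"
        using K by (intro mult_right_mono mult_left_mono fact_ge_1) auto
      then show "K * fact h \<le> K * fact H * fact h" by simp
    qed (use K in auto)
    then show ?thesis using large[OF True s] by linarith
  next
    case False
    have "real (fact H) \<le> real (H ^ H)"
      using fact_le_power[of H, where 'a = nat] by (simp only: of_nat_le_iff) simp
    then have "real n powr (1 / real (H + 1)) * fact H \<le> real (H ^ H) * real n powr (1 / real (H + 1))"
      by (simp add: mult.commute mult_right_mono)
    also have "\<dots> \<le> real n powr (1 / real H)"
      using H n by (intro powr_inverse_ge) auto
    also have "\<dots> \<le> real n powr (1 / real (h + 1))"
    proof (rule powr_mono)
      have "H ^ (H * (H + 1)) \<ge> 1" using H by simp
      then show "1 \<le> real n" using base by linarith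
    qed (use False in \<open>auto simp: field_simps\<close>)
    also have "\<dots> \<le> real n powr (1 / real (h + 1)) * fact h"
      using fact_ge_1[of h, where 'a = real] by (simp add: mult_le_cancel_left1)
    finally have "c * (real n powr (1 / real (H + 1)) * fact H) \<le> real s"
      using c s by (meson mult_left_mono less_imp_le order.trans)
    then have "real n ^ 2 * real s / (K * fact H) \<le> D" by (intro large) auto
    moreover have "real n ^ 2 * real s / (K * fact H * fact h) \<le> real n ^ 2 * real s / (K * fact H)"
    proof (rule divide_left_mono)
      have "K * fact H * 1 \<le> K * fact H * fact h"
        using K by (intro mult_left_mono fact_ge_1) auto
      then show "K * fact H \<le> K * fact H * fact h" by simp
    qed (use K in auto)
    ultimately show ?thesis by linarith
  qed
qed

section \<open>Matching bounds\<close>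

theorem corollary2p6:
  "\<exists>C2 > (0::real). \<forall>j::nat \<ge> 2. \<forall>c > (0::real). \<exists>C1 > (0::real). \<exists>N::nat.
     \<forall>n \<ge> N. \<forall>s::nat \<ge> 1. \<forall>t::nat \<ge> 1.
       real s \<ge> c * (real n powr (1 / real t) * fact (t - 1)) \<longrightarrow>
         C1 * (real n ^ 2 * real s / fact (t - 1)) \<le> real (DS_max s n j) \<and>
         real (DS_max s n j) \<le> C2 * (real n ^ 2 * real s)"
proof (rule exI[of _ "1::real"], intro conjI allI impI)
  fix j :: nat and c :: real
  assume j: "j \<ge> 2" and c: "c > 0"
  obtain H where H: "\<And>h. h \<ge> H \<Longrightarrow>
      2 ^ (h + 4) \<le> c * fact h \<and> 4 * j ^ 2 * 2 ^ h \<le> h ^ h \<and> 2 * h ^ 2 \<le> h ^ h \<and> h \<ge> 2"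
    using eventually_admissible[OF c, of j] by blast
  define K where "K = 2048 * real j ^ 2"
  have "K > 0" using j by (simp add: K_def)
  have wide: "real n ^ 2 * real s / (K * fact h) \<le> real (DS_max s n j)"
    if "h \<ge> H" "h ^ (h * (h + 1)) \<le> n" "c * (real n powr (1 / real (h + 1)) * fact h) \<le> real s" for h n s
    unfolding K_def using H[OF that(1)] that(2,3) j
    by (intro DS_max_ge_large_n[of j h c n s]) auto
  show "\<exists>C1 > (0::real). \<exists>N::nat. \<forall>n \<ge> N. \<forall>s::nat \<ge> 1. \<forall>t::nat \<ge> 1.
       real s \<ge> c * (real n powr (1 / real t) * fact (t - 1)) \<longrightarrow>
         C1 * (real n ^ 2 * real s / fact (t - 1)) \<le> real (DS_max s n j) \<and>
         real (DS_max s n j) \<le> 1 * (real n ^ 2 * real s)"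
  proof (intro exI[of _ "1 / (K * fact H)"] exI[of _ "(H ^ H) ^ (H * (H + 1))"] conjI allI impI)
    fix n s t :: nat
    assume n: "n \<ge> (H ^ H) ^ (H * (H + 1))" and s: "s \<ge> 1" and t: "t \<ge> 1"
      and large: "real s \<ge> c * (real n powr (1 / real t) * fact (t - 1))"
    have "real n ^ 2 * real s / (K * fact H * fact (t - 1)) \<le> real (DS_max s n j)"
      using H[of H] t large by (intro lower_bound_all_exponents[OF c _ wide \<open>K > 0\<close> n]) auto
    then show "1 / (K * fact H) * (real n ^ 2 * real s / fact (t - 1)) \<le> real (DS_max s n j)"
      by simp
    have "real (DS_max s n j) \<le> real (n ^ 2 * s)"
      using DS_max_le[OF s] by (simp only: of_nat_le_iff)
    then show "real (DS_max s n j) \<le> 1 * (real n ^ 2 * real s)" by simp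
  qed (use \<open>K > 0\<close> in simp)
qed simp

end
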